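(* Let $m\ge2$ be an integer, let $\lambda,\mu$ be non-zero real constants with $\lambda\neq-1$, let $I\subset(0,\infty)$ be an open interval and let $u:I\to\mathbb R$ be a smooth function with $u'(\alpha)\neq0$ for all $\alpha\in I$. The rotational surface in $(\mathbb R^3,\|\cdot\|)$ given by $$\bar X(\alpha,v)=(\alpha\cos v,\ \alpha\sin v,\ u(\alpha)),\qquad \alpha\in I,$$ satisfies $k_1+\lambda k_2=\mu$ (at every point) if and only if $$u(\alpha)=\pm\int\frac{\left\{c_1(\lambda+1)-\mu\alpha^{\lambda+1}\right\}^{2m-1}}{\left[(\lambda+1)^{2m}\alpha^{2m\lambda}-\left\{c_1(\lambda+1)-\mu\alpha^{\lambda+1}\right\}^{2m}\right]^{\frac{2m-1}{2m}}}\,d\alpha$$ for some real constant $c_1$, where one needs $$0<c_1-\frac{\mu}{\lambda+1}\alpha^{\lambda+1}<\alpha^{\lambda}\qquad\text{for all }\alpha\in I;$$ that is, if and only if there are $c_1\in\mathbb R$ satisfying these inequalities on $I$ and a sign (constant on $I$) such that $u$ is an antiderivative on $I$ of $\pm$ the displayed integrand.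
   Context: The norm on $\mathbb R^3$ is $\|x\|=\left((x_1^2+x_2^2)^m+x_3^{2m}\right)^{1/(2m)}$, with $m\ge2$ an integer. Put $\Phi(x)=(x_1^2+x_2^2)^m+x_3^{2m}$; the unit sphere is $S=\{\Phi=1\}$. For an immersed surface $M$ in $(\mathbb R^3,\|\cdot\|)$, a Birkhoff-Gauss map is a local map $\eta:M\to S$ such that, for each $p$, the tangent plane of $S$ at $\eta(p)$ is parallel to $T_pM$ (it is determined up to sign); the principal curvatures are the eigenvalues of $d\eta_p$. Choice of sign and labelling: the surface $\bar X$ with $u'\ne0$ is regarded as reparametrized by height, $X(u,v)=(\alpha(u)\cos v,\alpha(u)\sin v,u)$, where $\alpha(u)>0$ is the inverse function of $u(\alpha)$, so that $\alpha'\neq0$. The map $\eta$ is fixed by $(\operatorname{grad}\Phi)_\eta=\varphi\,X_u\times X_v$ with $\varphi>0$ ($\times$ the standard cross product), and $k_1,k_2$ are the principal curvatures in the profile and rotation directions: $\eta_u=k_1X_u$, $\eta_v=k_2X_v$. Explicitly (with primes denoting $d/du$, odd roots of negative numbers being the real ones), $$k_1=\frac1{2m-1}\left((\alpha')^{\frac{2m}{2m-1}}+1\right)^{-\frac{2m+1}{2m}}(\alpha')^{-\frac{2m-2}{2m-1}}\alpha'',\qquad k_2=-\frac1\alpha\left((\alpha')^{\frac{2m}{2m-1}}+1\right)^{-\frac1{2m}}.$$ *)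

theory Defs
  imports "HOL-Analysis.Analysis"
begin

definition Phi :: "nat \<Rightarrow> real^3 \<Rightarrow> real" where
  "Phi m x = ((x$1)\<^sup>2 + (x$2)\<^sup>2) ^ m + (x$3) ^ (2 * m)"

definition mnorm :: "nat \<Rightarrow> real^3 \<Rightarrow> real" where
  "mnorm m x = root (2 * m) (Phi m x)"

definition unit_sphere :: "nat \<Rightarrow> (real^3) set" where
  "unit_sphere m = {x. mnorm m x = 1}"

text \<open>The unit sphere is the regular level set on which \<open>Phi m\<close> equals 1; its tangent plane at one of
  its points (translated to the origin) is the kernel of the differential of \<open>Phi m\<close>.\<close>

definition sphere_tangent :: "nat \<Rightarrow> real^3 \<Rightarrow> (real^3) set" where
  "sphere_tangent m q = {w. frechet_derivative (Phi m) (at q) w = 0}"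

text \<open>A surface is given by a parametrization \<open>X\<close> of an open set of parameters \<open>(s, v)\<close>, and a map
  on the surface is given as a function of these parameters. The partial derivatives of \<open>X\<close> are the
  values of its differential at \<open>(1, 0)\<close> and \<open>(0, 1)\<close>.\<close>

abbreviation differential :: "(real \<times> real \<Rightarrow> real^3) \<Rightarrow> real \<times> real \<Rightarrow> real \<times> real \<Rightarrow> real^3" where
  "differential X p \<equiv> frechet_derivative X (at p)"

text \<open>The first two clauses say that \<open>\<eta>\<close> is a Birkhoff-Gauss map; this determines it up to sign.
  The last clause fixes the sign.\<close>

definition birkhoff_gauss_map ::
  "nat \<Rightarrow> (real \<times> real \<Rightarrow> real^3) \<Rightarrow> (real \<times> real) set \<Rightarrow> (real \<times> real \<Rightarrow> real^3) \<Rightarrow> bool" where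
  "birkhoff_gauss_map m X D \<eta> \<longleftrightarrow>
     (\<forall>p\<in>D. \<eta> p \<in> unit_sphere m \<and>
        sphere_tangent m (\<eta> p) = range (differential X p) \<and>
        (\<exists>\<phi>>0. GDERIV (Phi m) (\<eta> p) :>
           \<phi> *\<^sub>R cross3 (differential X p (1, 0)) (differential X p (0, 1))))"

text \<open>The tangent vector \<open>differential X p w\<close> is an eigenvector, with eigenvalue \<open>k\<close>, of the
  differential of \<open>\<eta>\<close> regarded as an endomorphism of the tangent plane of the surface.\<close>

definition principal_curvature ::
  "(real \<times> real \<Rightarrow> real^3) \<Rightarrow> (real \<times> real \<Rightarrow> real^3) \<Rightarrow> real \<times> real \<Rightarrow> real \<times> real \<Rightarrow> real \<Rightarrow> bool" where
  "principal_curvature X \<eta> p w k \<longleftrightarrow>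
     \<eta> differentiable (at p) \<and> differential X p w \<noteq> 0 \<and>
     differential \<eta> p w = k *\<^sub>R differential X p w"

definition rot_surface :: "(real \<Rightarrow> real) \<Rightarrow> real \<times> real \<Rightarrow> real^3" where
  "rot_surface u = (\<lambda>(a, v). vector [a * cos v, a * sin v, u a])"

text \<open>Reparametrization by height: since \<open>u\<close> is injective on the interval \<open>I\<close>, for \<open>s \<in> u ` I\<close> the
  value at \<open>(s, v)\<close> is \<open>(\<alpha> s * cos v, \<alpha> s * sin v, s)\<close> with \<open>\<alpha>\<close> the inverse of \<open>u\<close>. For decreasing
  \<open>u\<close> this reverses the orientation of \<open>rot_surface u\<close>, hence the sign of the curvatures.\<close>

definition height_param :: "real set \<Rightarrow> (real \<Rightarrow> real) \<Rightarrow> real \<times> real \<Rightarrow> real^3" where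
  "height_param I u = (\<lambda>(s, v). rot_surface u (the_inv_into I u s, v))"

text \<open>For an open set \<open>I\<close> this is infinite differentiability on \<open>I\<close>.\<close>

definition smooth_on :: "real set \<Rightarrow> (real \<Rightarrow> real) \<Rightarrow> bool" where
  "smooth_on I u \<longleftrightarrow> (\<forall>n. \<forall>a\<in>I. (deriv ^^ n) u differentiable (at a))"

definition integrand :: "nat \<Rightarrow> real \<Rightarrow> real \<Rightarrow> real \<Rightarrow> real \<Rightarrow> real" where
  "integrand m lam mu c a =
     (c * (lam + 1) - mu * a powr (lam + 1)) ^ (2 * m - 1) /
     ((lam + 1) ^ (2 * m) * a powr (2 * real m * lam) - (c * (lam + 1) - mu * a powr (lam + 1)) ^ (2 * m))
       powr ((2 * real m - 1) / (2 * real m))"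

end

theory Submission
  imports Defs
begin

text \<open>
  On the meridian \<open>v = 0\<close> write the Birkhoff-Gauss image as \<open>(- R, 0, z)\<close>, with \<open>R\<close> and \<open>z\<close> seen as
  functions of the radius \<open>a\<close>. Being normal to the surface and on the unit sphere means
  \<open>u' = (R / z)^(2m-1)\<close> and \<open>R^(2m) + z^(2m) = 1\<close>, so that \<open>0 < R < 1\<close> and \<open>R\<close> determines \<open>u'\<close> up to
  sign. The curvatures are \<open>k1 = - R'\<close> and \<open>k2 = - R / a\<close>; hence \<open>k1 + lam k2 = mu\<close> is the linear
  equation \<open>(a^lam R)' = - mu a^lam\<close>, that is, \<open>a^lam R = c - mu a^(lam+1) / (lam+1)\<close>. The integrand
  of the theorem is \<open>sgn (lam+1) (R / \<bar>z\<bar>)^(2m-1)\<close> for this \<open>R\<close>, and its sign is absorbed in \<open>\<sigma>\<close>.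
\<close>

section \<open>Gradient of \<open>Phi m\<close> and differentials of maps of rotational form\<close>

lemma GDERIV_Phi:
  assumes "m \<ge> 1"
  shows "GDERIV (Phi m) x :>
    vector [2 * real m * ((x$1)\<^sup>2 + (x$2)\<^sup>2) ^ (m - 1) * x$1,
            2 * real m * ((x$1)\<^sup>2 + (x$2)\<^sup>2) ^ (m - 1) * x$2,
            2 * real m * (x$3) ^ (2 * m - 1)]"
  unfolding gderiv_def Phi_def
  by (auto intro!: derivative_eq_intros bounded_linear.has_derivative[OF bounded_linear_vec_nth]
      simp: inner_vec_def sum_3 fun_eq_iff algebra_simps)

text \<open>Covers both the surface parametrized by height and the Birkhoff-Gauss map built in the
  converse direction, so that one derivative formula serves for the two.\<close>

definition rotational :: "(real \<Rightarrow> real) \<Rightarrow> (real \<Rightarrow> real) \<Rightarrow> real \<times> real \<Rightarrow> real^3" where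
  "rotational f g = (\<lambda>(s, v). vector [f s * cos v, f s * sin v, g s])"

lemma has_derivative_vector_3:
  fixes f1 f2 f3 :: "'a::real_normed_vector \<Rightarrow> real"
  assumes "(f1 has_derivative f1') F" "(f2 has_derivative f2') F" "(f3 has_derivative f3') F"
  shows "((\<lambda>x. vector [f1 x, f2 x, f3 x] :: real^3) has_derivative
           (\<lambda>h. vector [f1' h, f2' h, f3' h])) F"
proof -
  have eq: "(\<lambda>x. vector [g1 x, g2 x, g3 x] :: real^3) =
      (\<lambda>x. g1 x *\<^sub>R axis 1 1 + g2 x *\<^sub>R axis 2 1 + g3 x *\<^sub>R axis 3 1)"
    for g1 g2 g3 :: "'a \<Rightarrow> real"
    by (auto simp: fun_eq_iff vec_eq_iff forall_3 axis_def)
  show ?thesis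
    unfolding eq by (intro derivative_intros assms)
qed

lemma rotational_has_derivative:
  assumes f: "(f has_real_derivative f') (at s)" and g: "(g has_real_derivative g') (at s)"
  shows "(rotational f g has_derivative
           (\<lambda>(h, k). vector [h * f' * cos v - k * f s * sin v,
                             h * f' * sin v + k * f s * cos v, h * g'])) (at (s, v))"
proof -
  have fst': "(fst has_derivative fst) (at (s, v))" and snd': "(snd has_derivative snd) (at (s, v))"
    by (auto intro!: derivative_eq_intros)
  have F: "((\<lambda>p. f (fst p)) has_derivative (\<lambda>h. fst h * f')) (at (s, v))"
    and G: "((\<lambda>p. g (fst p)) has_derivative (\<lambda>h. fst h * g')) (at (s, v))"
    using has_derivative_compose[OF fst', of f "(*) f'"] has_derivative_compose[OF fst', of g "(*) g'"]
      f g by (auto simp: has_field_derivative_def mult.commute)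
  have C: "((\<lambda>p. cos (snd p)) has_derivative (\<lambda>h. - (snd h * sin v))) (at (s, v))"
    and S: "((\<lambda>p. sin (snd p)) has_derivative (\<lambda>h. snd h * cos v)) (at (s, v))"
    by (auto intro!: derivative_eq_intros simp: fun_eq_iff)
  have "((\<lambda>p. vector [f (fst p) * cos (snd p), f (fst p) * sin (snd p), g (fst p)] :: real^3)
      has_derivative (\<lambda>h. vector [f s * - (snd h * sin v) + fst h * f' * cos v,
        f s * (snd h * cos v) + fst h * f' * sin v, fst h * g'])) (at (s, v))"
    using has_derivative_vector_3[OF has_derivative_mult[OF F C] has_derivative_mult[OF F S] G]
    by simp
  then show ?thesis
    unfolding rotational_def case_prod_beta' by (simp add: algebra_simps)
qed

section \<open>Inversion of the profile function and parametrization by height\<close>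

text \<open>By the mean value theorem, equal values at two points of the interval would force a zero
  of \<open>u'\<close> between them.\<close>

lemma inj_on_deriv_nonzero:
  fixes u :: "real \<Rightarrow> real"
  assumes I: "is_interval I" and D: "\<And>a. a \<in> I \<Longrightarrow> (u has_real_derivative u' a) (at a)"
    and nz: "\<And>a. a \<in> I \<Longrightarrow> u' a \<noteq> 0"
  shows "inj_on u I"
proof (rule linorder_inj_onI)
  fix a b assume ab: "a < b" "a \<in> I" "b \<in> I"
  have mem: "x \<in> I" if "a \<le> x" "x \<le> b" for x
    using I ab that by (meson mem_is_interval_1_I)
  obtain z where z: "a < z" "z < b" "u b - u a = (b - a) * u' z"
    using MVT2[of a b u u'] ab D mem by blast
  then show "u a \<noteq> u b"
    using nz[of z] mem[of z] ab by auto
qed (use assms in auto)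

lemma the_inv_into_has_derivative:
  fixes u :: "real \<Rightarrow> real"
  assumes "open I" and I: "is_interval I"
    and D: "\<And>a. a \<in> I \<Longrightarrow> (u has_real_derivative u' a) (at a)"
    and nz: "\<And>a. a \<in> I \<Longrightarrow> u' a \<noteq> 0" and "a \<in> I"
  shows "(the_inv_into I u has_real_derivative 1 / u' a) (at (u a))"
proof -
  have inj: "inj_on u I"
    using inj_on_deriv_nonzero[OF I D nz] .
  have cont: "continuous_on I u"
    using D by (meson DERIV_continuous_on has_field_derivative_at_within)
  show ?thesis
    unfolding has_field_derivative_def
  proof (rule has_derivative_inverse_strong[of I a u "the_inv_into I u" "(*) (u' a)"])
    show "(u has_derivative (*) (u' a)) (at a)"
      using D[OF \<open>a \<in> I\<close>] by (simp add: has_field_derivative_def)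
    show "(*) (u' a) \<circ> (*) (1 / u' a) = id"
      using nz[OF \<open>a \<in> I\<close>] by (auto simp: fun_eq_iff)
  qed (use assms cont inj in \<open>auto simp: the_inv_into_f_f\<close>)
qed

lemma height_param_has_derivative:
  assumes "open I" "is_interval I"
    and D: "\<And>a. a \<in> I \<Longrightarrow> (u has_real_derivative u' a) (at a)"
    and nz: "\<And>a. a \<in> I \<Longrightarrow> u' a \<noteq> 0" and a: "a \<in> I"
  shows "(height_param I u has_derivative
           (\<lambda>(h, k). vector [h * (1 / u' a) * cos v - k * a * sin v,
                             h * (1 / u' a) * sin v + k * a * cos v, h])) (at (u a, v))"
proof -
  let ?\<alpha> = "the_inv_into I u"
  have inv: "(?\<alpha> has_real_derivative 1 / u' a) (at (u a))"
    using the_inv_into_has_derivative[OF assms] .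
  have \<alpha>: "?\<alpha> (u a) = a"
    using inj_on_deriv_nonzero[OF assms(2) D nz] a by (simp add: the_inv_into_f_f)
  \<comment> \<open>The third coordinate is literally \<open>u (?\<alpha> s)\<close>, which is known
    to be \<open>s\<close> only on the image of \<open>I\<close>; the chain rule gives its
    derivative 1.\<close>
  have "((\<lambda>s. u (?\<alpha> s)) has_real_derivative 1) (at (u a))"
    using DERIV_chain2[OF _ inv, of u "u' a"] D[OF a] nz[OF a] \<alpha> by simp
  moreover have "height_param I u = rotational ?\<alpha> (\<lambda>s. u (?\<alpha> s))"
    by (simp add: height_param_def rot_surface_def rotational_def)
  ultimately show ?thesis
    using rotational_has_derivative[OF inv, of _ 1 v] \<alpha> by simp
qed

section \<open>The integrand, and auxiliary facts on signs and derivatives\<close>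

text \<open>With \<open>L = lam + 1\<close> and \<open>A = a powr lam\<close>, the base in the
  numerator is \<open>L * A * R\<close>, and the sphere equation turns the bracket in the
  denominator into the 2m-th power of \<open>\<bar>L\<bar> * A * Z\<close>. The factors
  \<open>A\<close> and \<open>\<bar>L\<bar>\<close> cancel, and the odd exponent 2m-1 leaves the
  sign of \<open>L\<close>.\<close>

lemma integrand_eq:
  assumes "m \<ge> 1" "a > 0" "lam \<noteq> -1" "Z > 0" and RZ: "R ^ (2*m) + Z ^ (2*m) = 1"
    and R: "a powr lam * R = c - mu / (lam + 1) * a powr (lam + 1)"
  shows "integrand m lam mu c a = sgn (lam + 1) * (R / Z) ^ (2*m - 1)"
proof -
  define L where "L = lam + 1"
  define A where "A = a powr lam"
  have L: "L \<noteq> 0" and A: "A > 0" using assms by (auto simp: L_def A_def)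
  have P: "c * L - mu * a powr L = L * A * R"
    using arg_cong[OF R, of "(*) L"] L
    unfolding L_def[symmetric] A_def[symmetric] by (simp add: algebra_simps)
  have A2: "a powr (2 * real m * lam) = A ^ (2*m)"
    using \<open>a > 0\<close> by (simp add: A_def powr_realpow[symmetric] powr_powr mult.commute)
  \<comment> \<open>The bracket is an even power; taking the absolute value of \<open>L\<close>
    selects its positive root, to which the laws of \<open>powr\<close> apply.\<close>
  let ?B = "\<bar>L\<bar> * A * Z"
  have B: "?B > 0" using L A assms by simp
  have "L ^ (2*m) * A ^ (2*m) - (L * A * R) ^ (2*m) = L ^ (2*m) * A ^ (2*m) * (1 - R ^ (2*m))"
    by (simp add: power_mult_distrib algebra_simps)
  also have "1 - R ^ (2*m) = Z ^ (2*m)" using RZ by simp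
  also have "L ^ (2*m) * A ^ (2*m) * Z ^ (2*m) = ?B ^ (2*m)"
    by (simp add: power_mult_distrib power_even_abs)
  finally have den: "L ^ (2*m) * A ^ (2*m) - (L * A * R) ^ (2*m) = ?B ^ (2*m)" .
  have "(?B ^ (2*m)) powr ((2 * real m - 1) / (2 * real m)) = ?B powr (2 * real m - 1)"
    using B \<open>m \<ge> 1\<close> by (simp add: powr_realpow[symmetric] powr_powr)
  also have "\<dots> = ?B powr real (2*m - 1)"
    using \<open>m \<ge> 1\<close> by (simp add: of_nat_diff)
  also have "\<dots> = ?B ^ (2*m - 1)"
    using B by (rule powr_realpow)
  finally have "integrand m lam mu c a = (L * A * R) ^ (2*m - 1) / ?B ^ (2*m - 1)"
    unfolding integrand_def L_def[symmetric] P A2 den by simp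
  also have "\<dots> = (sgn L * (R / Z)) ^ (2*m - 1)"
    using L A \<open>Z > 0\<close>
    by (simp add: power_divide[symmetric] sgn_if abs_if)
  also have "\<dots> = sgn L * (R / Z) ^ (2*m - 1)"
    using \<open>m \<ge> 1\<close> by (auto simp: power_mult_distrib sgn_if)
  finally show ?thesis by (simp add: L_def)
qed

text \<open>The image of an interval is an interval, so values of opposite sign would put 0 into it.
  Applied to the derivative of \<open>u\<close>, this makes the sign in the theorem constant on
  \<open>I\<close>.\<close>

lemma sgn_constant_on_interval:
  fixes f :: "real \<Rightarrow> real"
  assumes "is_interval I" "continuous_on I f" "\<And>a. a \<in> I \<Longrightarrow> f a \<noteq> 0" "a \<in> I" "b \<in> I"
  shows "sgn (f a) = sgn (f b)"
proof (rule ccontr)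
  assume "sgn (f a) \<noteq> sgn (f b)"
  then have "f a < 0 \<and> f b > 0 \<or> f b < 0 \<and> f a > 0"
    using assms(3)[OF assms(4)] assms(3)[OF assms(5)] by (auto simp: sgn_if split: if_splits)
  moreover have "is_interval (f ` I)"
    using assms by (simp add: connected_continuous_image is_interval_connected_1)
  ultimately have "0 \<in> f ` I"
    using assms(4,5) mem_is_interval_1_I[of "f ` I" "f a" "f b" 0]
      mem_is_interval_1_I[of "f ` I" "f b" "f a" 0] by auto
  then show False using assms by auto
qed

text \<open>Shows \<open>a powr lam\<close> to be the integrating factor for R' + lam R / a. The
  exponent \<open>lam\<close> serves to integrate the equation, \<open>- lam\<close> to
  differentiate its solution.\<close>

lemma powr_mult_has_derivative:
  assumes "(R has_real_derivative R') (at a)" "a > 0"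
  shows "((\<lambda>x. x powr lam * R x) has_real_derivative a powr lam * (R' + lam * R a / a)) (at a)"
  by (rule derivative_eq_intros assms refl)+
    (use assms in \<open>simp add: powr_diff field_simps\<close>)

lemma GDERIV_unique:
  assumes "GDERIV f x :> d" "GDERIV f x :> d'"
  shows "d = d'"
proof -
  have "h \<bullet> d = h \<bullet> d'" for h
    using has_derivative_unique assms unfolding gderiv_def by metis
  then show ?thesis
    using vector_eq_rdot[of d d'] by (simp add: inner_commute)
qed

lemma mnorm_eq_1_iff:
  assumes "m \<ge> 1"
  shows "mnorm m x = 1 \<longleftrightarrow> Phi m x = 1"
  using assms by (simp add: mnorm_def)

section \<open>Tangent planes and normals of the surface\<close>

locale profile =
  fixes I :: "real set" and u u' :: "real \<Rightarrow> real"
  assumes open_I: "open I" and interval_I: "is_interval I" and I_pos: "I \<subseteq> {0<..}"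
    and deriv_u: "\<And>a. a \<in> I \<Longrightarrow> (u has_real_derivative u' a) (at a)"
    and nz: "\<And>a. a \<in> I \<Longrightarrow> u' a \<noteq> 0"
begin

abbreviation "X \<equiv> height_param I u"

lemma pos: "a \<in> I \<Longrightarrow> a > 0"
  using I_pos by auto

lemma inv_u: "a \<in> I \<Longrightarrow> the_inv_into I u (u a) = a"
  using inj_on_deriv_nonzero[OF interval_I deriv_u nz] by (simp add: the_inv_into_f_f)

lemma differential_X:
  assumes "a \<in> I"
  shows "differential X (u a, v) =
    (\<lambda>(h, k). vector [h * (1 / u' a) * cos v - k * a * sin v,
                      h * (1 / u' a) * sin v + k * a * cos v, h])"
  using height_param_has_derivative[OF open_I interval_I deriv_u nz assms]
  by (simp add: frechet_derivative_at[symmetric])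

text \<open>The horizontal part points towards the axis whatever the sign of \<open>u'\<close>, and
  only the vertical part carries that sign. Hence the horizontal component of the Birkhoff-Gauss map
  is \<open>- R\<close> with \<open>R\<close> positive.\<close>

lemma normal_X:
  assumes "a \<in> I"
  shows "cross3 (differential X (u a, v) (1, 0)) (differential X (u a, v) (0, 1)) =
    vector [- (a * cos v), - (a * sin v), a / u' a]"
proof -
  have "cos v * (a * cos v) + sin v * (a * sin v) = a * ((cos v)\<^sup>2 + (sin v)\<^sup>2)"
    by (simp only: power2_eq_square algebra_simps)
  then show ?thesis
    using nz[OF assms] unfolding differential_X[OF assms]
    by (simp add: cross3_def vec_eq_iff forall_3 field_simps)
qed

lemma range_differential_X:
  assumes "a \<in> I"
  shows "range (differential X (u a, v)) =
    {w. w \<bullet> vector [- (a * cos v), - (a * sin v), a / u' a] = 0}"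
proof (intro equalityI subsetI)
  fix w assume "w \<in> range (differential X (u a, v))"
  then obtain h k where w: "w = vector [h * (1 / u' a) * cos v - k * a * sin v,
      h * (1 / u' a) * sin v + k * a * cos v, h]"
    unfolding differential_X[OF assms] by auto
  \<comment> \<open>The sum of the two squares is left unevaluated, so that this is an identity of
    polynomials in the sine and cosine.\<close>
  have "w \<bullet> vector [- (a * cos v), - (a * sin v), a / u' a]
      = a * h / u' a * (1 - ((cos v)\<^sup>2 + (sin v)\<^sup>2))"
    unfolding w by (simp add: inner_vec_def sum_3 power2_eq_square divide_inverse algebra_simps
        del: sin_cos_squared_add sin_cos_squared_add2 sin_cos_squared_add3)
  then show "w \<in> {w. w \<bullet> vector [- (a * cos v), - (a * sin v), a / u' a] = 0}"
    by simp
next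
  fix w :: "real^3" assume "w \<in> {w. w \<bullet> vector [- (a * cos v), - (a * sin v), a / u' a] = 0}"
  then have "a * (w$3 / u' a - (w$1 * cos v + w$2 * sin v)) = 0"
    by (simp add: inner_vec_def sum_3 algebra_simps)
  then have w3: "w$3 / u' a = w$1 * cos v + w$2 * sin v"
    using pos[OF assms] by simp
  \<comment> \<open>The first coordinate of a preimage of \<open>w\<close> must be
    \<open>w$3\<close>, since only the profile direction has a vertical part. Projecting
    \<open>w\<close> horizontally on (- sin v, cos v) gives the second.\<close>
  define k where "k = (w$2 * cos v - w$1 * sin v) / a"
  have k: "k * a = w$2 * cos v - w$1 * sin v"
    using pos[OF assms] by (simp add: k_def)
  have "w$3 * (1 / u' a) * cos v - k * a * sin v = w$1 * ((cos v)\<^sup>2 + (sin v)\<^sup>2)"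
    unfolding times_divide_eq_right mult_1_right w3 k by (simp add: algebra_simps power2_eq_square
        del: sin_cos_squared_add sin_cos_squared_add2 sin_cos_squared_add3)
  moreover have "w$3 * (1 / u' a) * sin v + k * a * cos v = w$2 * ((cos v)\<^sup>2 + (sin v)\<^sup>2)"
    unfolding times_divide_eq_right mult_1_right w3 k by (simp add: algebra_simps power2_eq_square
        del: sin_cos_squared_add sin_cos_squared_add2 sin_cos_squared_add3)
  ultimately have "w = differential X (u a, v) (w$3, k)"
    unfolding differential_X[OF assms] by (simp add: vec_eq_iff forall_3)
  then show "w \<in> range (differential X (u a, v))"
    by (rule range_eqI)
qed

section \<open>Consequences of having a Birkhoff-Gauss map with the required curvatures\<close>

lemma birkhoff_gauss_gradient:
  assumes "m \<ge> 1" and bg: "birkhoff_gauss_map m X (u ` I \<times> UNIV) \<eta>" and a: "a \<in> I"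
  obtains \<phi> where "\<phi> > 0"
    "2 * real m * ((\<eta> (u a, v) $ 1)\<^sup>2 + (\<eta> (u a, v) $ 2)\<^sup>2) ^ (m - 1) * \<eta> (u a, v) $ 1
       = - (\<phi> * a * cos v)"
    "2 * real m * ((\<eta> (u a, v) $ 1)\<^sup>2 + (\<eta> (u a, v) $ 2)\<^sup>2) ^ (m - 1) * \<eta> (u a, v) $ 2
       = - (\<phi> * a * sin v)"
    "2 * real m * (\<eta> (u a, v) $ 3) ^ (2 * m - 1) = \<phi> * a / u' a"
proof -
  have "(u a, v) \<in> u ` I \<times> UNIV" using a by auto
  then obtain \<phi> where "\<phi> > 0" and
    "GDERIV (Phi m) (\<eta> (u a, v)) :> \<phi> *\<^sub>R vector [- (a * cos v), - (a * sin v), a / u' a]"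
    using bg normal_X[OF a] unfolding birkhoff_gauss_map_def by metis
  from GDERIV_unique[OF GDERIV_Phi[OF \<open>m \<ge> 1\<close>] this(2)] \<open>\<phi> > 0\<close> show thesis
    by (intro that[of \<phi>]) (simp_all add: vec_eq_iff forall_3 mult.assoc)
qed

text \<open>The horizontal gradient of \<open>Phi m\<close> is a scalar \<open>?r\<close> times the
  horizontal part of \<open>\<eta>\<close>, and the sign clause makes it a multiple of (cos v, sin
  v). The scalar is non-zero because cos v and sin v do not vanish together.\<close>

lemma birkhoff_gauss_rotational:
  assumes "m \<ge> 1" and bg: "birkhoff_gauss_map m X (u ` I \<times> UNIV) \<eta>" and a: "a \<in> I"
  shows "\<eta> (u a, v) $ 1 * sin v = \<eta> (u a, v) $ 2 * cos v"
proof -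
  let ?r = "2 * real m * ((\<eta> (u a, v) $ 1)\<^sup>2 + (\<eta> (u a, v) $ 2)\<^sup>2) ^ (m - 1)"
  obtain \<phi> where \<phi>: "\<phi> > 0" "?r * \<eta> (u a, v) $ 1 = - (\<phi> * a * cos v)"
    "?r * \<eta> (u a, v) $ 2 = - (\<phi> * a * sin v)"
    using birkhoff_gauss_gradient[OF assms] by metis
  have "?r \<noteq> 0"
  proof
    assume "?r = 0"
    then have "cos v = 0" "sin v = 0"
      using \<phi> pos[OF a] by auto
    then show False using sin_cos_squared_add[of v] by simp
  qed
  moreover have "?r * (\<eta> (u a, v) $ 1 * sin v) = ?r * (\<eta> (u a, v) $ 2 * cos v)"
    unfolding mult.assoc[of ?r, symmetric] \<phi>(2,3) by simp
  ultimately show ?thesis using mult_left_cancel by blast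
qed

text \<open>Eliminating \<open>\<phi>\<close> between the first and third gradient equations gives
  z^(2m-1) u' = R^(2m-1) for the signed height z. Absolute values are then taken, and the sign of
  \<open>u'\<close> is put back as a factor.\<close>

lemma birkhoff_gauss_meridian:
  assumes "m \<ge> 1" and bg: "birkhoff_gauss_map m X (u ` I \<times> UNIV) \<eta>" and a: "a \<in> I"
  defines "R \<equiv> - (\<eta> (u a, 0) $ 1)" and "Z \<equiv> \<bar>\<eta> (u a, 0) $ 3\<bar>"
  shows "R > 0" "Z > 0" "R ^ (2 * m) + Z ^ (2 * m) = 1"
    "u' a = sgn (u' a) * (R / Z) ^ (2 * m - 1)"
proof -
  define z where "z = \<eta> (u a, 0) $ 3"
  have q2: "\<eta> (u a, 0) $ 2 = 0"
    using birkhoff_gauss_rotational[OF assms(1-3), of 0] by simp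
  obtain \<phi> where \<phi>: "\<phi> > 0" "2 * real m * (R\<^sup>2) ^ (m - 1) * R = \<phi> * a"
    "2 * real m * z ^ (2 * m - 1) = \<phi> * a / u' a"
    by (rule birkhoff_gauss_gradient[OF assms(1-3), of 0])
      (use q2 in \<open>simp add: R_def z_def\<close>)
  have "0 < 2 * real m * (R\<^sup>2) ^ (m - 1) * R"
    using \<phi> pos[OF a] by simp
  \<comment> \<open>A non-negative coefficient with a positive product forces the other factor
    \<open>R\<close> to be positive.\<close>
  moreover have "0 \<le> 2 * real m * (R\<^sup>2) ^ (m - 1)"
    by simp
  ultimately show R: "R > 0"
    by (simp only: zero_less_mult_iff) linarith
  have e: "2 * m - 1 = Suc (2 * (m - 1))"
    using \<open>m \<ge> 1\<close> by simp
  have "2 * real m * R ^ (2 * m - 1) = \<phi> * a"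
    using \<phi>(2) unfolding e by (simp add: power_mult ac_simps)
  then have "2 * real m * (z ^ (2 * m - 1) * u' a) = 2 * real m * R ^ (2 * m - 1)"
    using \<phi>(3) nz[OF a] by (simp add: field_simps)
  then have zu: "z ^ (2 * m - 1) * u' a = R ^ (2 * m - 1)"
    using \<open>m \<ge> 1\<close> by simp
  then have z: "z \<noteq> 0"
    using R \<open>m \<ge> 1\<close> by (auto simp: zero_power)
  then show "Z > 0" by (simp add: Z_def z_def)
  have "(u a, 0) \<in> u ` I \<times> UNIV" using a by auto
  then have "Phi m (\<eta> (u a, 0)) = 1"
    using bg mnorm_eq_1_iff[OF \<open>m \<ge> 1\<close>] unfolding birkhoff_gauss_map_def unit_sphere_def by blast
  then show "R ^ (2 * m) + Z ^ (2 * m) = 1"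
    using q2 by (simp add: Phi_def R_def Z_def power_mult)
  have "\<bar>z ^ (2 * m - 1)\<bar> = Z ^ (2 * m - 1)"
    by (simp add: power_abs Z_def z_def)
  then have "\<bar>u' a\<bar> * Z ^ (2 * m - 1) = R ^ (2 * m - 1)"
    using arg_cong[OF zu, of abs] R by (simp add: abs_mult power_abs mult.commute)
  then have "\<bar>u' a\<bar> = (R / Z) ^ (2 * m - 1)"
    using \<open>Z > 0\<close> by (simp add: power_divide field_simps)
  then show "u' a = sgn (u' a) * (R / Z) ^ (2 * m - 1)"
    using sgn_mult_abs[of "u' a"] by simp
qed

lemma curvatures_meridian:
  assumes "m \<ge> 1" and bg: "birkhoff_gauss_map m X (u ` I \<times> UNIV) \<eta>" and a: "a \<in> I"
    and k1: "principal_curvature X \<eta> (u a, 0) (1, 0) k1"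
    and k2: "principal_curvature X \<eta> (u a, 0) (0, 1) k2"
  defines "R \<equiv> \<lambda>x. - (\<eta> (u x, 0) $ 1)"
  shows "(R has_real_derivative - k1) (at a)" "k2 = - R a / a"
proof -
  let ?L = "differential \<eta> (u a, 0)"
  have L: "(\<eta> has_derivative ?L) (at (u a, 0))"
    using k1 frechet_derivative_works by (auto simp: principal_curvature_def)
  interpret L: bounded_linear ?L
    using L by (rule has_derivative_bounded_linear)
  have L1: "?L (1, 0) = k1 *\<^sub>R vector [1 / u' a, 0, 1]"
    and L2: "?L (0, 1) = k2 *\<^sub>R vector [0, a, 0]"
    using k1 k2 by (simp_all add: principal_curvature_def differential_X[OF a])
  \<comment> \<open>The meridian is followed by its radius \<open>x\<close> instead of its height;
    the factor \<open>u'\<close> from the chain rule cancels the 1 / u' in the profile tangent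
    vector.\<close>
  have "((\<lambda>x. (u x, 0 :: real)) has_derivative (\<lambda>h. (u' a * h, 0))) (at a)"
    using deriv_u[OF a]
    by (auto intro!: has_derivative_Pair simp: has_field_derivative_def)
  from has_derivative_compose[OF this, of \<eta> ?L]
  have "((\<lambda>x. \<eta> (u x, 0)) has_derivative (\<lambda>h. ?L (u' a * h, 0))) (at a)"
    using L by simp
  from bounded_linear.has_derivative[OF bounded_linear_vec_nth[of 1] this]
  have "((\<lambda>x. - (\<eta> (u x, 0) $ 1)) has_derivative (\<lambda>h. - (?L (u' a * h, 0) $ 1))) (at a)"
    by (rule has_derivative_minus)
  moreover have "?L (u' a * h, 0) = (u' a * h) *\<^sub>R ?L (1, 0)" for h
    using L.scaleR[of "u' a * h" "(1, 0)"] by simp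
  moreover from this have "(\<lambda>h. - (?L (u' a * h, 0) $ 1)) = (*) (- k1)"
    using nz[OF a] by (simp add: L1 fun_eq_iff)
  ultimately show "(R has_real_derivative - k1) (at a)"
    unfolding R_def has_field_derivative_def by simp
  \<comment> \<open>\<open>\<eta>\<close> is horizontally parallel to \<open>(cos v, sin v)\<close>; differentiating this at \<open>v = 0\<close> gives \<open>k2\<close>
    without knowing that the length of the horizontal part is independent of \<open>v\<close>.\<close>
  let ?\<psi> = "\<lambda>v. \<eta> (u a, v) $ 2 * cos v - \<eta> (u a, v) $ 1 * sin v"
  have "((\<lambda>v. (u a, v)) has_derivative (\<lambda>h. (0, h))) (at 0)"
    by (auto intro!: derivative_eq_intros)
  from has_derivative_compose[OF this, of \<eta> ?L]
  have E: "((\<lambda>v. \<eta> (u a, v)) has_derivative (\<lambda>h. ?L (0, h))) (at 0)"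
    using L by simp
  have L2': "?L (0, h) = h *\<^sub>R ?L (0, 1)" for h
    using L.scaleR[of h "(0, 1)"] by simp
  have E': "((\<lambda>v. \<eta> (u a, v) $ i) has_real_derivative ?L (0, 1) $ i) (at 0)" for i
  proof -
    have "(\<lambda>h. ?L (0, h) $ i) = (*) (?L (0, 1) $ i)"
      by (rule ext, subst L2') (simp add: mult.commute)
    then show ?thesis
      using bounded_linear.has_derivative[OF bounded_linear_vec_nth[of i] E]
      by (simp only: has_field_derivative_def)
  qed
  have "(?\<psi> has_real_derivative k2 * a - \<eta> (u a, 0) $ 1) (at 0)"
    by (rule derivative_eq_intros E' refl)+ (simp add: L2)
  moreover have "?\<psi> = (\<lambda>v. 0)"
    using birkhoff_gauss_rotational[OF assms(1-3)] by auto
  ultimately have "k2 * a - \<eta> (u a, 0) $ 1 = 0"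
    using DERIV_unique DERIV_const by metis
  then show "k2 = - R a / a"
    using pos[OF a] by (simp add: R_def field_simps)
qed

lemma meridian_equation:
  assumes "m \<ge> 1" "lam \<noteq> -1"
    and bg: "birkhoff_gauss_map m X (u ` I \<times> UNIV) \<eta>"
    and pc: "\<And>p. p \<in> u ` I \<times> UNIV \<Longrightarrow>
      principal_curvature X \<eta> p (1, 0) (k1 p) \<and> principal_curvature X \<eta> p (0, 1) (k2 p) \<and>
      k1 p + lam * k2 p = mu"
  obtains c where
    "\<And>a. a \<in> I \<Longrightarrow> a powr lam * - (\<eta> (u a, 0) $ 1) = c - mu / (lam + 1) * a powr (lam + 1)"
proof -
  define R where "R = (\<lambda>x. - (\<eta> (u x, 0) $ 1))"
  \<comment> \<open>A first integral: by the power rule, which uses \<open>lam \<noteq> -1\<close>,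
    the second summand has derivative \<open>mu * x powr lam\<close>, and the linear equation for
    \<open>R\<close> makes the first one cancel it.\<close>
  define W where "W = (\<lambda>x. x powr lam * R x + mu / (lam + 1) * x powr (lam + 1))"
  have "(W has_real_derivative 0) (at a within I)" if a: "a \<in> I" for a
  proof -
    have "(u a, 0) \<in> u ` I \<times> UNIV" using a by auto
    from pc[OF this] curvatures_meridian[OF \<open>m \<ge> 1\<close> bg a, of "k1 (u a, 0)" "k2 (u a, 0)"]
    have R: "(R has_real_derivative - k1 (u a, 0)) (at a)"
      and k: "k1 (u a, 0) - lam * R a / a = mu"
      by (auto simp: R_def)
    have "((\<lambda>x. mu / (lam + 1) * x powr (lam + 1)) has_real_derivative mu * a powr lam) (at a)"
      using pos[OF a] \<open>lam \<noteq> -1\<close> by (auto intro!: derivative_eq_intros)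
    from DERIV_add[OF powr_mult_has_derivative[OF R pos[OF a], of lam] this]
    have "(W has_real_derivative
        a powr lam * (- k1 (u a, 0) + lam * R a / a) + mu * a powr lam) (at a)"
      unfolding W_def .
    also have "a powr lam * (- k1 (u a, 0) + lam * R a / a) + mu * a powr lam = 0"
      unfolding k[symmetric] by (simp add: algebra_simps)
    finally have "(W has_real_derivative 0) (at a)" .
    then show ?thesis by (rule has_field_derivative_at_within)
  qed
  then obtain c where c: "\<And>a. a \<in> I \<Longrightarrow> W a = c"
    using has_field_derivative_zero_constant[of I W] interval_I
    by (auto simp: is_interval_convex)
  show thesis
  proof (rule that[of c])
    fix a assume "a \<in> I"
    from c[OF this] show "a powr lam * - (\<eta> (u a, 0) $ 1) = c - mu / (lam + 1) * a powr (lam + 1)"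
      unfolding W_def R_def by linarith
  qed
qed

section \<open>Construction of the Birkhoff-Gauss map from a solution of the linear equation\<close>

lemma rotational_birkhoff_gauss_map:
  assumes "m \<ge> 1" and \<tau>: "\<tau> \<in> {1, -1}"
    and RZ: "\<And>a. a \<in> I \<Longrightarrow> R a > 0" "\<And>a. a \<in> I \<Longrightarrow> Z a > 0"
      "\<And>a. a \<in> I \<Longrightarrow> R a ^ (2 * m) + Z a ^ (2 * m) = 1"
      "\<And>a. a \<in> I \<Longrightarrow> u' a = \<tau> * (R a / Z a) ^ (2 * m - 1)"
  defines "\<eta> \<equiv> rotational (\<lambda>s. - R (the_inv_into I u s)) (\<lambda>s. \<tau> * Z (the_inv_into I u s))"
  shows "birkhoff_gauss_map m X (u ` I \<times> UNIV) \<eta>"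
  unfolding birkhoff_gauss_map_def
proof (rule ballI)
  fix p :: "real \<times> real" assume "p \<in> u ` I \<times> UNIV"
  then obtain a v where p: "p = (u a, v)" and a: "a \<in> I" by auto
  let ?N = "vector [- (a * cos v), - (a * sin v), a / u' a] :: real^3"
  have \<eta>: "\<eta> p = vector [- R a * cos v, - R a * sin v, \<tau> * Z a]"
    by (simp add: p \<eta>_def rotational_def inv_u[OF a])
  have "(R a * cos v)\<^sup>2 + (R a * sin v)\<^sup>2 = (R a)\<^sup>2 * ((cos v)\<^sup>2 + (sin v)\<^sup>2)"
    by (simp only: power_mult_distrib algebra_simps)
  then have r: "(R a * cos v)\<^sup>2 + (R a * sin v)\<^sup>2 = (R a)\<^sup>2" by simp
  have \<tau>2: "\<tau>\<^sup>2 = 1" and \<tau>n: "\<tau> ^ (2 * m - 1) = \<tau>"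
    using \<tau> \<open>m \<ge> 1\<close> by auto
  have sphere: "\<eta> p \<in> unit_sphere m"
    using RZ(3)[OF a] \<tau>2 \<open>m \<ge> 1\<close>
    by (simp add: \<eta> unit_sphere_def mnorm_eq_1_iff Phi_def r power_mult power_mult_distrib[of \<tau>])
  \<comment> \<open>The factor is dictated by the horizontal components of the gradient; the
    vertical component then agrees by the formula for \<open>u' a\<close>.\<close>
  define \<phi> where "\<phi> = 2 * real m * R a ^ (2 * m - 1) / a"
  have \<phi>: "\<phi> > 0"
    using RZ(1)[OF a] pos[OF a] \<open>m \<ge> 1\<close> by (simp add: \<phi>_def)
  have e: "2 * m - 1 = Suc (2 * (m - 1))"
    using \<open>m \<ge> 1\<close> by simp
  have \<phi>a: "\<phi> * a = 2 * real m * ((R a)\<^sup>2) ^ (m - 1) * R a"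
    using pos[OF a] unfolding \<phi>_def e by (simp add: power_mult)
  have "\<phi> * (a / u' a) = 2 * real m * (R a ^ (2 * m - 1) / u' a)"
    using pos[OF a] by (simp add: \<phi>_def)
  also have "R a ^ (2 * m - 1) / u' a = (\<tau> * Z a) ^ (2 * m - 1)"
    using RZ(1,2)[OF a] \<tau>
    unfolding RZ(4)[OF a] power_mult_distrib \<tau>n power_divide by auto
  finally have \<phi>3: "2 * real m * (\<tau> * Z a) ^ (2 * m - 1) = \<phi> * (a / u' a)" by simp
  have "GDERIV (Phi m) (\<eta> p) :> \<phi> *\<^sub>R ?N"
  proof -
    have "vector [2 * real m * ((\<eta> p$1)\<^sup>2 + (\<eta> p$2)\<^sup>2) ^ (m - 1) * \<eta> p$1,
            2 * real m * ((\<eta> p$1)\<^sup>2 + (\<eta> p$2)\<^sup>2) ^ (m - 1) * \<eta> p$2,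
            2 * real m * (\<eta> p$3) ^ (2 * m - 1)] = \<phi> *\<^sub>R ?N"
      using \<phi>3 arg_cong[OF \<phi>a[symmetric], of "\<lambda>x. x * cos v"]
        arg_cong[OF \<phi>a[symmetric], of "\<lambda>x. x * sin v"]
      unfolding vec_eq_iff forall_3 \<eta> by (simp add: r mult.assoc)
    then show ?thesis using GDERIV_Phi[OF \<open>m \<ge> 1\<close>, of "\<eta> p"] by simp
  qed
  \<comment> \<open>The kernel of the differential is the orthogonal complement of the gradient,
    hence that of \<open>?N\<close>, because \<open>\<phi>\<close> is non-zero.\<close>
  moreover from this have "sphere_tangent m (\<eta> p) = {w. w \<bullet> ?N = 0}"
    using \<phi> unfolding sphere_tangent_def gderiv_def
    by (simp add: frechet_derivative_at[symmetric])
  ultimately show "\<eta> p \<in> unit_sphere m \<and> sphere_tangent m (\<eta> p) = range (differential X p) \<and>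
      (\<exists>\<phi>>0. GDERIV (Phi m) (\<eta> p) :>
        \<phi> *\<^sub>R cross3 (differential X p (1, 0)) (differential X p (0, 1)))"
    using sphere \<phi> unfolding p normal_X[OF a] range_differential_X[OF a] by blast
qed

text \<open>The derivative assumed for \<open>Z\<close> is what differentiating R^(2m) + Z^(2m) = 1
  gives. Multiplied by \<open>\<tau>\<close> and divided by \<open>u' a\<close> it becomes
  \<open>- R'\<close>, so both components of the profile derivative of \<open>\<eta>\<close> are
  \<open>- R'\<close> times those of the surface.\<close>

lemma rotational_principal_curvatures:
  assumes "m \<ge> 1" and \<tau>: "\<tau> \<in> {1, -1}" and a: "a \<in> I"
    and R: "(R has_real_derivative R') (at a)"
    and Z: "(Z has_real_derivative - ((R a / Z a) ^ (2 * m - 1)) * R') (at a)"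
    and u': "u' a = \<tau> * (R a / Z a) ^ (2 * m - 1)"
  defines "\<eta> \<equiv> rotational (\<lambda>s. - R (the_inv_into I u s)) (\<lambda>s. \<tau> * Z (the_inv_into I u s))"
  shows "principal_curvature X \<eta> (u a, v) (1, 0) (- R')"
    and "principal_curvature X \<eta> (u a, v) (0, 1) (- R a / a)"
proof -
  have inv: "(the_inv_into I u has_real_derivative 1 / u' a) (at (u a))"
    using the_inv_into_has_derivative[OF open_I interval_I deriv_u nz a] .
  have f: "((\<lambda>s. - R (the_inv_into I u s)) has_real_derivative - (R' * (1 / u' a))) (at (u a))"
    by (intro DERIV_minus DERIV_chain2[OF _ inv]) (simp add: inv_u[OF a] R)
  have "((\<lambda>s. \<tau> * Z (the_inv_into I u s)) has_real_derivative
      \<tau> * (- ((R a / Z a) ^ (2 * m - 1)) * R' * (1 / u' a))) (at (u a))"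
    by (intro DERIV_cmult DERIV_chain2[OF _ inv]) (use Z in \<open>simp add: inv_u[OF a]\<close>)
  also have "\<tau> * (- ((R a / Z a) ^ (2 * m - 1)) * R' * (1 / u' a))
      = - R' * ((\<tau> * (R a / Z a) ^ (2 * m - 1)) / u' a)"
    by (simp add: algebra_simps)
  also have "\<dots> = - R'"
    unfolding u'[symmetric] using nz[OF a] by simp
  finally have "(\<eta> has_derivative
      (\<lambda>(h, k). vector [h * - (R' * (1 / u' a)) * cos v - k * - R a * sin v,
         h * - (R' * (1 / u' a)) * sin v + k * - R a * cos v, h * - R'])) (at (u a, v))"
    using rotational_has_derivative[OF f, of _ "- R'" v] by (simp add: \<eta>_def inv_u[OF a])
  then have diff: "\<eta> differentiable (at (u a, v))"
    and D: "differential \<eta> (u a, v) = (\<lambda>(h, k). vector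
      [h * - (R' * (1 / u' a)) * cos v - k * - R a * sin v,
         h * - (R' * (1 / u' a)) * sin v + k * - R a * cos v, h * - R'])"
    by (auto simp: frechet_derivative_at[symmetric] differentiable_def)
  \<comment> \<open>Makes the rotation vector (- a sin v, a cos v, 0) non-zero, as an eigenvector
    must be.\<close>
  have "sin v \<noteq> 0 \<or> cos v \<noteq> 0"
    using sin_zero_abs_cos_one[of v] by auto
  then show "principal_curvature X \<eta> (u a, v) (1, 0) (- R')"
    and "principal_curvature X \<eta> (u a, v) (0, 1) (- R a / a)"
    using pos[OF a] diff unfolding principal_curvature_def D differential_X[OF a]
    by (auto simp: vec_eq_iff forall_3)
qed

lemma curvatures_if_meridian_equation:
  assumes "m \<ge> 1" "lam \<noteq> -1" and \<tau>: "\<tau> \<in> {1, -1}"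
    and R: "\<And>a. a \<in> I \<Longrightarrow> a powr lam * R a = c - mu / (lam + 1) * a powr (lam + 1)"
    and RZ: "\<And>a. a \<in> I \<Longrightarrow> R a > 0" "\<And>a. a \<in> I \<Longrightarrow> Z a > 0"
      "\<And>a. a \<in> I \<Longrightarrow> R a ^ (2 * m) + Z a ^ (2 * m) = 1"
      "\<And>a. a \<in> I \<Longrightarrow> u' a = \<tau> * (R a / Z a) ^ (2 * m - 1)"
  shows "\<exists>\<eta> k1 k2. birkhoff_gauss_map m X (u ` I \<times> UNIV) \<eta> \<and>
            (\<forall>p \<in> u ` I \<times> UNIV.
               principal_curvature X \<eta> p (1, 0) (k1 p) \<and>
               principal_curvature X \<eta> p (0, 1) (k2 p) \<and>
               k1 p + lam * k2 p = mu)"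
proof -
  define \<eta> where
    "\<eta> = rotational (\<lambda>s. - R (the_inv_into I u s)) (\<lambda>s. \<tau> * Z (the_inv_into I u s))"
  \<comment> \<open>The value that the linear equation prescribes for the derivative of
    \<open>R\<close>; below it is obtained from the explicit solution.\<close>
  define R' where "R' a = - mu - lam * R a / a" for a
  have curv: "principal_curvature X \<eta> (u a, v) (1, 0) (- R' a) \<and>
      principal_curvature X \<eta> (u a, v) (0, 1) (- R a / a)" if a: "a \<in> I" for a v
  proof -
    \<comment> \<open>The formulas for \<open>R\<close> and \<open>Z\<close> hold on
      \<open>I\<close> only; openness of \<open>I\<close> lets their derivatives be transferred at
      \<open>a\<close>.\<close>
    have near: "\<forall>\<^sub>F x in nhds a. x \<in> I"
      using open_I a by (simp add: eventually_nhds_in_open)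
    let ?W = "\<lambda>x. c - mu / (lam + 1) * x powr (lam + 1)"
    have Req: "R x = x powr (- lam) * ?W x" if "x \<in> I" for x
      using R[OF that, symmetric] pos[OF that] by (simp add: powr_minus)
    have "(?W has_real_derivative - (mu * a powr lam)) (at a)"
      using pos[OF a] \<open>lam \<noteq> -1\<close> by (auto intro!: derivative_eq_intros)
    from powr_mult_has_derivative[OF this pos[OF a], of "- lam"]
    have "((\<lambda>x. x powr (- lam) * ?W x) has_real_derivative R' a) (at a)"
      unfolding R'_def R[OF a, symmetric] using pos[OF a]
      by (simp add: algebra_simps powr_minus)
    then have dR: "(R has_real_derivative R' a) (at a)"
      using DERIV_cong_ev[OF refl eventually_mono[OF near Req] refl] by simp
    \<comment> \<open>The sphere equation and positivity determine \<open>Z\<close>, which makes it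
      differentiable as a power of a positive function.\<close>
    have Zeq: "Z x = (1 - R x ^ (2 * m)) powr (1 / (2 * real m))" if "x \<in> I" for x
    proof -
      have "1 - R x ^ (2 * m) = Z x ^ (2 * m)"
        using RZ(3)[OF that] by simp
      also have "\<dots> powr (1 / (2 * real m)) = Z x"
        using RZ(2)[OF that] \<open>m \<ge> 1\<close> by (simp add: powr_realpow[symmetric] powr_powr)
      finally show ?thesis by simp
    qed
    have Za: "1 - R a ^ (2 * m) = Z a ^ (2 * m)"
      using RZ(3)[OF a] by simp
    have dP: "((\<lambda>x. 1 - R x ^ (2 * m)) has_real_derivative
        - (real (2 * m) * R a ^ (2 * m - 1) * R' a)) (at a)"
      by (auto intro!: derivative_eq_intros dR)
    have "((\<lambda>x. (1 - R x ^ (2 * m)) powr (1 / (2 * real m))) has_real_derivative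
        1 / (2 * real m) * (1 - R a ^ (2 * m)) powr (1 / (2 * real m) - 1) *
        (- (real (2 * m) * R a ^ (2 * m - 1) * R' a))) (at a)"
      using DERIV_fun_powr[OF dP, of "1 / (2 * real m)"] Za RZ(2)[OF a] by simp
    also have "1 / (2 * real m) * (1 - R a ^ (2 * m)) powr (1 / (2 * real m) - 1) *
        (- (real (2 * m) * R a ^ (2 * m - 1) * R' a))
      = - (Z a / Z a ^ (2 * m)) * R a ^ (2 * m - 1) * R' a"
      using \<open>m \<ge> 1\<close> RZ(2)[OF a] Zeq[OF a, symmetric] Za by (simp add: powr_diff)
    also have "Z a / Z a ^ (2 * m) = 1 / Z a ^ (2 * m - 1)"
      using \<open>m \<ge> 1\<close> RZ(2)[OF a] by (simp add: power_diff)
    finally have "((\<lambda>x. (1 - R x ^ (2 * m)) powr (1 / (2 * real m))) has_real_derivative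
        - ((R a / Z a) ^ (2 * m - 1)) * R' a) (at a)"
      by (simp add: power_divide)
    then have dZ: "(Z has_real_derivative - ((R a / Z a) ^ (2 * m - 1)) * R' a) (at a)"
      using DERIV_cong_ev[OF refl eventually_mono[OF near Zeq] refl] by simp
    show ?thesis
      unfolding \<eta>_def
      using rotational_principal_curvatures[OF \<open>m \<ge> 1\<close> \<tau> a dR dZ RZ(4)[OF a]] by blast
  qed
  show ?thesis
  proof (intro exI conjI ballI)
    show "birkhoff_gauss_map m X (u ` I \<times> UNIV) \<eta>"
      unfolding \<eta>_def by (rule rotational_birkhoff_gauss_map[OF \<open>m \<ge> 1\<close> \<tau> RZ])
    fix p :: "real \<times> real" assume "p \<in> u ` I \<times> UNIV"
    then obtain a v where p: "p = (u a, v)" and a: "a \<in> I" by auto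
    \<comment> \<open>The curvatures do not depend on the angle; the radius is recovered from the
      height by the inverse of \<open>u\<close>.\<close>
    let ?k1 = "\<lambda>p. - R' (the_inv_into I u (fst p))"
      and ?k2 = "\<lambda>p. - R (the_inv_into I u (fst p)) / the_inv_into I u (fst p)"
    show "principal_curvature X \<eta> p (1, 0) (?k1 p)" "principal_curvature X \<eta> p (0, 1) (?k2 p)"
      "?k1 p + lam * ?k2 p = mu"
      using curv[OF a, of v] by (simp_all add: p inv_u[OF a] R'_def)
  qed
qed

end

section \<open>The two directions of the equivalence\<close>

theorem theorem6p2:
  fixes m :: nat and lam mu :: real and I :: "real set" and u :: "real \<Rightarrow> real"
  assumes "m \<ge> 2"
    and "lam \<noteq> 0" and "mu \<noteq> 0" and "lam \<noteq> -1"
    and "open I" and "is_interval I" and "I \<noteq> {}" and "I \<subseteq> {0<..}"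
    and "smooth_on I u"
    and "\<forall>a\<in>I. deriv u a \<noteq> 0"
  shows "(\<exists>\<eta> k1 k2.
            birkhoff_gauss_map m (height_param I u) (u ` I \<times> UNIV) \<eta> \<and>
            (\<forall>p \<in> u ` I \<times> UNIV.
               principal_curvature (height_param I u) \<eta> p (1, 0) (k1 p) \<and>
               principal_curvature (height_param I u) \<eta> p (0, 1) (k2 p) \<and>
               k1 p + lam * k2 p = mu))
     \<longleftrightarrow>
         (\<exists>c1. (\<forall>a\<in>I. 0 < c1 - mu / (lam + 1) * a powr (lam + 1) \<and>
                      c1 - mu / (lam + 1) * a powr (lam + 1) < a powr lam) \<and>
               (\<exists>\<sigma>\<in>{1, -1}. \<forall>a\<in>I. (u has_real_derivative \<sigma> * integrand m lam mu c1 a) (at a)))"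
    (is "?curv \<longleftrightarrow> (\<exists>c. ?bounds c \<and> ?prim c)")
proof -
  have m: "m \<ge> 1" using assms by simp
  have deriv_u: "(u has_real_derivative deriv u a) (at a)" if "a \<in> I" for a
    using \<open>smooth_on I u\<close>[unfolded smooth_on_def, rule_format, of a 0] that
    by (simp add: DERIV_deriv_iff_real_differentiable)
  interpret profile I u "deriv u"
    by unfold_locales (use assms deriv_u in auto)
  \<comment> \<open>Smoothness of order 1 makes the derivative of \<open>u\<close> continuous, so
    that its sign is constant on \<open>I\<close>.\<close>
  have "deriv u differentiable (at a)" if "a \<in> I" for a
    using \<open>smooth_on I u\<close>[unfolded smooth_on_def, rule_format, of a 1] that by simp
  then have cont: "continuous_on I (deriv u)"
    by (intro differentiable_imp_continuous_on differentiable_at_imp_differentiable_on) auto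
  obtain b where b: "b \<in> I" using assms by auto
  have s: "sgn (lam + 1) \<in> {1, -1}"
    using \<open>lam \<noteq> -1\<close> by (auto simp: sgn_if)
  show ?thesis
  proof
    assume ?curv
    then obtain \<eta> k1 k2 where bg: "birkhoff_gauss_map m X (u ` I \<times> UNIV) \<eta>"
      and pc: "\<And>p. p \<in> u ` I \<times> UNIV \<Longrightarrow> principal_curvature X \<eta> p (1, 0) (k1 p) \<and>
        principal_curvature X \<eta> p (0, 1) (k2 p) \<and> k1 p + lam * k2 p = mu"
      by blast
    define R where "R a = - (\<eta> (u a, 0) $ 1)" for a
    define Z where "Z a = \<bar>\<eta> (u a, 0) $ 3\<bar>" for a
    obtain c where c: "\<And>a. a \<in> I \<Longrightarrow> a powr lam * R a = c - mu / (lam + 1) * a powr (lam + 1)"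
      using meridian_equation[OF m \<open>lam \<noteq> -1\<close> bg pc] unfolding R_def by metis
    note RZ = birkhoff_gauss_meridian[OF m bg, folded R_def Z_def]
    \<comment> \<open>This gives the upper bound on c: \<open>Z a\<close> is positive, so the sphere
      equation keeps \<open>R a\<close> strictly below 1.\<close>
    have R1: "R a < 1" if "a \<in> I" for a
    proof (rule ccontr)
      assume "\<not> R a < 1"
      then have "1 \<le> R a ^ (2 * m)" by simp
      moreover have "0 < Z a ^ (2 * m)" using RZ(2)[OF that] by simp
      ultimately show False using RZ(3)[OF that] by linarith
    qed
    have "0 < a powr lam * R a \<and> a powr lam * R a < a powr lam" if "a \<in> I" for a
      using RZ(1)[OF that] R1[OF that] pos[OF that] by simp
    then have "?bounds c"
      using c by simp
    moreover have "?prim c"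
    proof (intro bexI ballI)
      \<comment> \<open>The sign of \<open>u'\<close>, read off at the reference point
        \<open>b\<close>, times the sign that the integrand carries by
        \<open>integrand_eq\<close>.\<close>
      let ?\<sigma> = "sgn (deriv u b) * sgn (lam + 1)"
      show "?\<sigma> \<in> {1, -1}"
        using s nz[OF b] by (auto simp: sgn_if)
      fix a assume a: "a \<in> I"
      have "sgn (deriv u a) = sgn (deriv u b)"
        by (rule sgn_constant_on_interval[OF interval_I cont nz a b])
      then have "deriv u a = ?\<sigma> * integrand m lam mu c a"
        using RZ(4)[OF a] s integrand_eq[OF m pos[OF a] \<open>lam \<noteq> -1\<close> RZ(2)[OF a] RZ(3)[OF a] c[OF a]]
        by auto
      then show "(u has_real_derivative ?\<sigma> * integrand m lam mu c a) (at a)"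
        using deriv_u[OF a] by simp
    qed
    ultimately show "\<exists>c. ?bounds c \<and> ?prim c" by blast
  next
    assume "\<exists>c. ?bounds c \<and> ?prim c"
    then obtain c \<sigma> where bounds: "?bounds c" and \<sigma>: "\<sigma> \<in> {1, -1}"
      and prim: "\<And>a. a \<in> I \<Longrightarrow> (u has_real_derivative \<sigma> * integrand m lam mu c a) (at a)"
      by blast
    \<comment> \<open>\<open>R\<close> is solved from the integrated linear equation and
      \<open>Z\<close> from the sphere equation; the bounds on c say exactly that \<open>R\<close>
      lies between 0 and 1.\<close>
    define R where "R a = (c - mu / (lam + 1) * a powr (lam + 1)) / a powr lam" for a
    define Z where "Z a = root (2 * m) (1 - R a ^ (2 * m))" for a
    have R: "a powr lam * R a = c - mu / (lam + 1) * a powr (lam + 1)"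
      and R0: "R a > 0" and R1: "R a < 1" if "a \<in> I" for a
      using bounds that pos[OF that] by (auto simp: R_def)
    have R2: "R a ^ (2 * m) < 1" if "a \<in> I" for a
      using R0[OF that] R1[OF that] m by (simp add: power_less_one_iff)
    have Z0: "Z a > 0" and RZ: "R a ^ (2 * m) + Z a ^ (2 * m) = 1" if "a \<in> I" for a
      using R2[OF that] m by (simp_all add: Z_def)
    have "deriv u a = (\<sigma> * sgn (lam + 1)) * (R a / Z a) ^ (2 * m - 1)" if a: "a \<in> I" for a
      using DERIV_unique[OF deriv_u[OF a] prim[OF a]]
        integrand_eq[OF m pos[OF a] \<open>lam \<noteq> -1\<close> Z0[OF a] RZ[OF a] R[OF a]] by simp
    \<comment> \<open>This product is the sign of \<open>u'\<close> and serves as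
      \<open>\<tau>\<close>, the sign of the vertical component of the Birkhoff-Gauss map.\<close>
    moreover have "\<sigma> * sgn (lam + 1) \<in> {1, -1}"
      using \<sigma> s by auto
    ultimately show ?curv
      using curvatures_if_meridian_equation[OF m \<open>lam \<noteq> -1\<close> _ R R0 Z0 RZ] by blast
  qed
qed

end
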